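(* Let $\rho^*=e^{-U}$ on $\mathbb{R}$ with $U(x)=\frac{x^2}{2}+\ln\sqrt{2\pi}$ and let $F[\rho]=\mathrm{KL}[\rho|\rho^*]$. Let $\rho_0(x)=\frac{1}{D_0}e^{-V_0(x)}$ with $V_0(x)=\frac{x^2}{2}$ for $x\in(-1,1)$, $V_0(x)=|x|-\frac12$ otherwise, and $D_0=\int_{\mathbb{R}}e^{-V_0(x)}dx$. Let $(h_n)_{n\ge0}$ be any step sizes with $h_n\in(0,1)$, and let $\rho_{n+1}=(T_n)_\#\rho_n$, where $T_n(x)=x-h_n\nabla\frac{\delta F}{\delta\rho}\big|_{\rho_n}(x)$, the velocity being given $\rho_n$-a.e. by $\nabla\frac{\delta F}{\delta\rho}\big|_{\rho_n}=\nabla U+\nabla\ln\rho_n$. Then $$F[\rho_n]>0.019\qquad\text{for all } n\ge0.$$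
   Context: The same symbol denotes a probability measure on $\mathbb{R}$ and its Lebesgue density. $T_\#\rho$ denotes the pushforward. $\mathrm{KL}[\rho|\rho^*]=\int \frac{d\rho}{d\rho^*}\ln\left(\frac{d\rho}{d\rho^*}\right)d\rho^*$ if $\rho\ll\rho^*$, and $+\infty$ otherwise. The symbol $\frac{\delta F}{\delta\rho}\big|_\rho$ is the first variation of $F$ at $\rho$; for $F=\mathrm{KL}[\cdot|e^{-U}]$ and $\rho=e^{-V}$, it is $1+U-V$, with gradient $\nabla U-\nabla V=\nabla U+\nabla\ln\rho$; this formula, evaluated $\rho_n$-a.e., is the velocity used in the forward Euler scheme. *)

theory Defs
  imports "HOL-Probability.Probability"
begin

text \<open>
  Unlike the library's \<^const>\<open>KL_divergence\<close>, which is the real number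
  \<open>\<integral> ln (dM/dN) dM\<close> (and \<open>0\<close> if that integral does not exist), this has the value \<open>\<infinity>\<close>
  when \<open>M\<close> is not absolutely continuous with respect to \<open>N\<close> or when the integral diverges.
  The integral of \<open>f ln f\<close> is taken as positive part minus negative part; as
  \<open>f ln f \<ge> - 1 / e\<close>, the negative part is finite for a probability measure \<open>N\<close>.
  The convention \<open>0 ln 0 = 0\<close> is automatic. The library writes
  \<open>absolutely_continuous N M\<close> for \<open>M << N\<close>.
\<close>

definition KL :: "'a measure \<Rightarrow> 'a measure \<Rightarrow> ereal" where
  "KL M N =
     (if absolutely_continuous N M then
        (let f = (\<lambda>x. enn2real (RN_deriv N M x))
         in enn2ereal (\<integral>\<^sup>+x. ennreal (f x * ln (f x)) \<partial>N)
            - enn2ereal (\<integral>\<^sup>+x. ennreal (- (f x * ln (f x))) \<partial>N))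
      else \<infinity>)"

text \<open>
  The first variation \<open>1 + U - V\<close> of \<open>KL[\<cdot>|exp (- U)]\<close> at the density \<open>r = exp (- V)\<close>.
\<close>

definition KL_first_variation :: "(real \<Rightarrow> real) \<Rightarrow> (real \<Rightarrow> real) \<Rightarrow> real \<Rightarrow> real" where
  "KL_first_variation U r x = 1 + U x + ln (r x)"

text \<open>
  \<open>v\<close> is the gradient of the first variation at \<open>M\<close>, as a function defined \<open>M\<close>-almost everywhere:
  \<open>M\<close> has a density \<open>r\<close> such that at \<open>M\<close>-almost every \<open>x\<close> the first variation is classically
  differentiable with derivative \<open>v x\<close>. Nothing is asked at the remaining points, so \<open>r\<close> may
  have jumps and gaps in its support. Positivity of \<open>r\<close> near \<open>x\<close> excludes the
  artificial value \<open>ln 0 = 0\<close>.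
\<close>

definition is_KL_velocity :: "(real \<Rightarrow> real) \<Rightarrow> real measure \<Rightarrow> (real \<Rightarrow> real) \<Rightarrow> bool" where
  "is_KL_velocity U M v \<longleftrightarrow>
     v \<in> borel_measurable borel \<and>
     (\<exists>r. r \<in> borel_measurable borel \<and> (\<forall>x. 0 \<le> r x) \<and>
          M = density lborel (\<lambda>x. ennreal (r x)) \<and>
          (AE x in M. (\<forall>\<^sub>F y in nhds x. 0 < r y) \<and>
             (KL_first_variation U r has_real_derivative v x) (at x)))"

text \<open>
  By \<open>is_KL_velocity_unique\<close> below, the choice matters only on an \<open>M\<close>-null set, and hence does not
  affect the pushforward in \<open>forward_euler\<close>.
\<close>

definition KL_velocity :: "(real \<Rightarrow> real) \<Rightarrow> real measure \<Rightarrow> real \<Rightarrow> real" where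
  "KL_velocity U M = (SOME v. is_KL_velocity U M v)"

definition euler_map :: "(real \<Rightarrow> real) \<Rightarrow> real \<Rightarrow> real measure \<Rightarrow> real \<Rightarrow> real" where
  "euler_map U h M x = x - h * KL_velocity U M x"

primrec forward_euler ::
  "(real \<Rightarrow> real) \<Rightarrow> (nat \<Rightarrow> real) \<Rightarrow> real measure \<Rightarrow> nat \<Rightarrow> real measure" where
  "forward_euler U h M 0 = M"
| "forward_euler U h M (Suc n) =
     distr (forward_euler U h M n) borel (euler_map U (h n) (forward_euler U h M n))"

definition gauss_potential :: "real \<Rightarrow> real" where
  "gauss_potential x = x\<^sup>2 / 2 + ln (sqrt (2 * pi))"

definition rho_star :: "real measure" where
  "rho_star = density lborel (\<lambda>x. ennreal (exp (- gauss_potential x)))"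

definition V0 :: "real \<Rightarrow> real" where
  "V0 x = (if x \<in> {-1<..<1} then x\<^sup>2 / 2 else \<bar>x\<bar> - 1 / 2)"

definition D0 :: real where
  "D0 = (\<integral>x. exp (- V0 x) \<partial>lborel)"

definition rho0 :: "real measure" where
  "rho0 = density lborel (\<lambda>x. ennreal (1 / D0 * exp (- V0 x)))"

lemma has_real_derivative_AE_0:
  fixes f :: "real \<Rightarrow> real"
  assumes "AE y in lborel. f y = 0" "f x = 0" "(f has_real_derivative d) (at x)"
  shows "d = 0"
proof (rule ccontr)
  assume "d \<noteq> 0"
  have "((\<lambda>y. (f y - f x) / (y - x)) \<longlongrightarrow> d) (at x)"
    using assms(3) by (simp add: has_field_derivative_iff)
  then have "\<forall>\<^sub>F y in at x. (f y - f x) / (y - x) \<noteq> 0"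
    using \<open>d \<noteq> 0\<close> by (rule tendsto_imp_eventually_ne)
  then have "\<forall>\<^sub>F y in at x. f y \<noteq> 0"
    by (rule eventually_mono) (use assms(2) in auto)
  then obtain S where S: "open S" "x \<in> S" "\<forall>y\<in>S. y \<noteq> x \<longrightarrow> f y \<noteq> 0"
    by (auto simp: eventually_at_topological)
  obtain e where e: "e > 0" "ball x e \<subseteq> S"
    using S openE by blast
  have "AE y in lborel. y \<notin> {x<..<x+e}"
    using assms(1) by eventually_elim (use S e in \<open>auto simp: subset_iff dist_real_def\<close>)
  then have "{x<..<x+e} \<in> null_sets lborel"
    by (subst (asm) AE_iff_null_sets[symmetric]) auto
  then show False
    using e by (auto simp: null_sets_def)
qed

lemma is_KL_velocity_unique:
  assumes "is_KL_velocity U M v" "is_KL_velocity U M w"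
  shows "AE x in M. v x = w x"
proof -
  obtain r where r: "r \<in> borel_measurable borel" "\<And>x. 0 \<le> r x"
      "M = density lborel (\<lambda>x. ennreal (r x))"
      "AE x in M. (KL_first_variation U r has_real_derivative v x) (at x)"
    using assms(1) unfolding is_KL_velocity_def by (auto elim: eventually_mono)
  obtain s where s: "s \<in> borel_measurable borel" "\<And>x. 0 \<le> s x"
      "M = density lborel (\<lambda>x. ennreal (s x))"
      "AE x in M. (KL_first_variation U s has_real_derivative w x) (at x)"
    using assms(2) unfolding is_KL_velocity_def by (auto elim: eventually_mono)
  have "AE x in lborel. ennreal (r x) = ennreal (s x)"
    using r s by (intro sigma_finite_measure.density_unique[OF lborel.sigma_finite_measure_axioms]) auto
  then have eq: "AE x in lborel. r x = s x"
    by eventually_elim (use r s in auto)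
  then have "AE x in M. r x = s x"
    unfolding r(3) using r(1) by (subst AE_density) (auto elim: eventually_mono)
  with r(4) s(4) show ?thesis
  proof eventually_elim
    case (elim x)
    have "v x - w x = 0"
    proof (rule has_real_derivative_AE_0)
      show "((\<lambda>y. KL_first_variation U r y - KL_first_variation U s y)
              has_real_derivative (v x - w x)) (at x)"
        using elim by (intro DERIV_diff)
      show "AE y in lborel. KL_first_variation U r y - KL_first_variation U s y = 0"
        using eq by eventually_elim (simp add: KL_first_variation_def)
    qed (use elim in \<open>simp add: KL_first_variation_def\<close>)
    then show ?case by simp
  qed
qed

end

theory Submission imports Defs begin

text \<open>
  On \<open>A = (-1, 1)\<close> the velocity vanishes, while the two tails of \<open>\<rho>\<^sub>n\<close> remain shifted
  exponentials \<open>exp (- (\<bar>x\<bar> - a) / s)\<close> on \<open>\<bar>x\<bar> \<ge> a\<close> with \<open>a \<ge> 1\<close> and \<open>s \<le> 1\<close>: a step of size \<open>h\<close>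
  sends \<open>(a, s)\<close> to \<open>(h / s + (1 - h) a, (1 - h) s)\<close>, so nothing ever enters \<open>A\<close>. Hence
  \<open>\<rho>\<^sub>n(A) = \<rho>\<^sub>0(A) \<approx> 0.585\<close> for all \<open>n\<close>, whereas \<open>\<rho>\<^sup>*(A) \<approx> 0.683\<close>. Already the divergence between
  the two-point distributions obtained by observing only \<open>A\<close> is about \<open>0.021\<close>, and it bounds the
  full divergence from below.
\<close>

section \<open>Dual lower bound for the relative entropy\<close>

text \<open>The integrable minorant \<open>f\<close> dominates the negative part of
  \<open>g\<close>, which is therefore finite. Either the positive part is infinite and the bound is
  trivial, or \<open>g\<close> is integrable and monotonicity of the integral applies.\<close>

lemma enn2ereal_diff_ge_integral:
  fixes f g :: "'a \<Rightarrow> real"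
  assumes f: "integrable N f" and g: "g \<in> borel_measurable N" and le: "AE x in N. f x \<le> g x"
  shows "ereal (\<integral>x. f x \<partial>N)
    \<le> enn2ereal (\<integral>\<^sup>+x. ennreal (g x) \<partial>N) - enn2ereal (\<integral>\<^sup>+x. ennreal (- g x) \<partial>N)"
proof -
  let ?P = "\<integral>\<^sup>+x. ennreal (g x) \<partial>N" and ?Q = "\<integral>\<^sup>+x. ennreal (- g x) \<partial>N"
  have "?Q \<le> (\<integral>\<^sup>+x. ennreal (norm (f x)) \<partial>N)"
    by (intro nn_integral_mono_AE eventually_mono[OF le]) (auto intro!: ennreal_leI)
  also have "\<dots> < \<infinity>"
    using f by (simp add: integrable_iff_bounded)
  finally have Q: "?Q < \<infinity>" .
  show ?thesis
  proof (cases "?P = \<infinity>")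
    case True
    then show ?thesis by simp
  next
    case False
    have int: "integrable N g"
      using g Q False by (simp add: real_integrable_def)
    have "(\<integral>x. f x \<partial>N) \<le> (\<integral>x. g x \<partial>N)"
      using f int le by (rule integral_mono_AE)
    also have "\<dots> = enn2real ?P - enn2real ?Q"
      using int by (rule real_lebesgue_integral_def)
    finally have "ereal (\<integral>x. f x \<partial>N) \<le> ereal (enn2real ?P) - ereal (enn2real ?Q)"
      by simp
    moreover have "enn2ereal e = ereal (enn2real e)" if "e \<noteq> \<infinity>" for e
      using that by (cases e) auto
    ultimately show ?thesis
      using Q False by (metis less_irrefl)
  qed
qed

text \<open>The left side is the tangent at \<open>y = exp c\<close> to the convex function
  \<open>y * ln y\<close>. Dividing by \<open>y > 0\<close> reduces the bound to
  \<open>1 + t \<le> exp t\<close> with \<open>t = c - ln y\<close>.\<close>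

lemma mult_ln_ge_tangent:
  fixes y c :: real
  assumes "0 \<le> y"
  shows "y * (1 + c) - exp c \<le> y * ln y"
proof (cases "y = 0")
  case False
  with assms have y: "0 < y" by simp
  have "1 + (c - ln y) \<le> exp (c - ln y)"
    by (rule exp_ge_add_one_self)
  then have "y * (1 + (c - ln y)) \<le> y * exp (c - ln y)"
    using y by simp
  also have "\<dots> = exp c"
    using y by (simp add: exp_diff)
  finally show ?thesis by (simp add: algebra_simps)
qed simp

text \<open>The easy half of the variational formula for the divergence: the tangent inequality with
  \<open>y = f x\<close> and \<open>c = \<psi> x\<close>, integrated against \<open>N\<close>. Any
  test function \<open>\<psi>\<close> gives a bound, and a two-valued one retains only the mass of a
  single set.\<close>

lemma KL_ge_dual:
  assumes "prob_space M" and "prob_space N" and sets: "sets M = sets N"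
    and psi: "integrable M \<psi>" and exp_psi: "integrable N (\<lambda>x. exp (\<psi> x))"
  shows "ereal (1 + (\<integral>x. \<psi> x \<partial>M) - (\<integral>x. exp (\<psi> x) \<partial>N)) \<le> KL M N"
proof (cases "absolutely_continuous N M")
  case True
  interpret M: prob_space M by fact
  interpret N: prob_space N by fact
  define f where "f x = enn2real (RN_deriv N M x)" for x
  have f_meas[measurable]: "f \<in> borel_measurable N"
    unfolding f_def by measurable
  have f_nonneg: "0 \<le> f x" for x
    by (simp add: f_def)
  have psi_meas[measurable]: "\<psi> \<in> borel_measurable N"
    using borel_measurable_integrable[OF psi] by (simp only: measurable_cong_sets[OF sets refl])
  \<comment> \<open>Finiteness almost everywhere ensures that \<open>enn2real\<close> in the
    definition of \<open>KL\<close> loses nothing.\<close>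
  have "AE x in N. RN_deriv N M x \<noteq> \<infinity>"
    using M.sigma_finite_measure_axioms True sets by (rule N.RN_deriv_finite)
  then have "AE x in N. ennreal (f x) = RN_deriv N M x"
    by eventually_elim (simp add: f_def less_top)
  then have "density N (\<lambda>x. ennreal (f x)) = density N (RN_deriv N M)"
    by (intro density_cong) auto
  then have M: "M = density N (\<lambda>x. ennreal (f x))"
    using N.density_RN_deriv[OF True sets] by simp
  have psi1: "integrable M (\<lambda>x. 1 + \<psi> x)"
    using psi by simp
  have int1: "integrable N (\<lambda>x. f x * (1 + \<psi> x))"
    using psi1 f_nonneg by (subst (asm) M) (simp add: integrable_density)
  have "1 + (\<integral>x. \<psi> x \<partial>M) = (\<integral>x. 1 + \<psi> x \<partial>M)"
    using psi by (simp add: M.prob_space)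
  also have "\<dots> = (\<integral>x. f x * (1 + \<psi> x) \<partial>N)"
    using f_nonneg by (subst M) (simp add: integral_density)
  finally have "1 + (\<integral>x. \<psi> x \<partial>M) - (\<integral>x. exp (\<psi> x) \<partial>N)
      = (\<integral>x. f x * (1 + \<psi> x) - exp (\<psi> x) \<partial>N)"
    using int1 exp_psi by simp
  moreover have "ereal (\<integral>x. f x * (1 + \<psi> x) - exp (\<psi> x) \<partial>N)
     \<le> enn2ereal (\<integral>\<^sup>+x. ennreal (f x * ln (f x)) \<partial>N)
        - enn2ereal (\<integral>\<^sup>+x. ennreal (- (f x * ln (f x))) \<partial>N)"
    using int1 exp_psi f_nonneg by (intro enn2ereal_diff_ge_integral) (auto intro: mult_ln_ge_tangent)
  ultimately show ?thesis
    using True by (simp add: KL_def f_def)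
qed (simp add: KL_def)

section \<open>Numerical estimates\<close>

text \<open>Taylor's formula with Lagrange remainder: the remainder carries
  \<open>(- y) ^ 4\<close>, which is nonnegative. One order further it carries
  \<open>(- y) ^ 5\<close>, which is nonpositive and gives the upper bound that follows.\<close>

lemma exp_minus_ge:
  fixes y :: real
  assumes "0 \<le> y"
  shows "1 - y + y\<^sup>2 / 2 - y ^ 3 / 6 \<le> exp (- y)"
proof -
  obtain t where "exp (- y) = (\<Sum>m<4. (- y) ^ m / fact m) + exp t / fact 4 * (- y) ^ 4"
    using Maclaurin_exp_le[of "- y" 4] by blast
  then show ?thesis
    using assms by (simp add: numeral_eq_Suc fact_numeral)
qed

lemma exp_minus_le:
  fixes y :: real
  assumes "0 \<le> y"
  shows "exp (- y) \<le> 1 - y + y\<^sup>2 / 2 - y ^ 3 / 6 + y ^ 4 / 24"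
proof -
  obtain t where "exp (- y) = (\<Sum>m<5. (- y) ^ m / fact m) + exp t / fact 5 * (- y) ^ 5"
    using Maclaurin_exp_le[of "- y" 5] by blast
  then show ?thesis
    using assms by (simp add: numeral_eq_Suc fact_numeral)
qed

lemma ln_6_7_ge: "- 0.1542 \<le> ln (6 / 7 :: real)"
  using exp_minus_le[of "0.1542"] by (subst ln_ge_iff) (simp_all add: power_numeral_reduce)

lemma ln_17_13_ge: "0.2679 \<le> ln (17 / 13 :: real)"
proof -
  \<comment> \<open>The exponential has been estimated at negative arguments, so the reciprocal is
    treated first.\<close>
  have "ln (13 / 17) \<le> (- 0.2679 :: real)"
    using exp_minus_ge[of "0.2679"] ln_mono[of "13 / 17 :: real" "exp (- 0.2679)"]
    by (simp add: power_numeral_reduce)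
  then show ?thesis by (simp add: ln_div)
qed

text \<open>\<open>sin (pi / 6) = 1 / 2\<close> and \<open>3.15 / 6 = 0.525\<close>. A larger
  \<open>pi\<close> would force \<open>sin 0.525 < 1 / 2\<close> by monotonicity, whereas the cubic
  Taylor polynomial with its error term gives \<open>sin 0.525 > 0.5005\<close>.\<close>

lemma pi_le: "pi \<le> 3.15"
proof (rule ccontr)
  assume "\<not> pi \<le> 3.15"
  then have "sin 0.525 < sin (pi / 6)"
    using pi_less_4 by (intro sin_monotone_2pi) auto
  moreover have "\<bar>sin 0.525 - (\<Sum>m<5. sin_coeff m * 0.525 ^ m)\<bar> \<le> inverse (fact 5) * \<bar>0.525\<bar> ^ 5"
    by (rule Maclaurin_sin_bound)
  moreover have "(\<Sum>m<5. sin_coeff m * 0.525 ^ m) = 0.525 - 0.525 ^ 3 / (6 :: real)"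
  proof -
    have "{..<5 :: nat} = {0, 1, 2, 3, 4}" by auto
    then show ?thesis by (simp add: sin_coeff_def fact_numeral)
  qed
  ultimately show False
    by (simp add: sin_30 fact_numeral power_numeral_reduce abs_le_iff)
qed

lemma sqrt_2_pi_le: "sqrt (2 * pi) \<le> 2.51"
  using pi_le by (intro real_le_lsqrt) (auto simp: power2_eq_square)

text \<open>The normalisation is left out because the same integral serves two measures: divided by
  \<open>D0\<close> it is the mass of \<open>(-1, 1)\<close> under every iterate, divided by
  \<open>sqrt (2 * pi)\<close> the mass under \<open>rho_star\<close>.\<close>

definition core_mass :: real where
  "core_mass = (\<integral>x. exp (- (x\<^sup>2 / 2)) * indicator {-1<..<1} x \<partial>lborel)"

lemma integrable_core: "integrable lborel (\<lambda>x. exp (- (x\<^sup>2 / 2)) * indicator {-1<..<1} x :: real)"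
  by (rule Bochner_Integration.integrable_bound[where f = "\<lambda>x. indicator {-1<..<1::real} x :: real"])
     (auto split: split_indicator)

lemma core_mass_bounds: "1.7107 \<le> core_mass" "core_mass \<le> 1.7113"
proof -
  \<comment> \<open>\<open>L\<close> and \<open>R\<close> are the Taylor bounds for
    \<open>exp (- y)\<close> at \<open>y = x\<^sup>2 / 2\<close>; as polynomials they are integrated
    exactly.\<close>
  define L where "L x = 1 - x\<^sup>2 / 2 + x ^ 4 / 8 - x ^ 6 / 48" for x :: real
  define R where "R x = L x + x ^ 8 / 384" for x :: real
  have L: "L x \<le> exp (- (x\<^sup>2 / 2))" for x
    using exp_minus_ge[of "x\<^sup>2 / 2"] by (simp add: L_def field_simps flip: power_mult)
  have R: "exp (- (x\<^sup>2 / 2)) \<le> R x" for x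
    using exp_minus_le[of "x\<^sup>2 / 2"] by (simp add: L_def R_def field_simps flip: power_mult)
  have "has_bochner_integral lborel (\<lambda>x. L x * indicator {-1..1} x)
      ((1 - 1^3 / 6 + 1^5 / 40 - 1^7 / 336) - (-1 - (-1)^3 / 6 + (-1)^5 / 40 - (-1)^7 / 336))"
    unfolding L_def
    by (rule has_bochner_integral_FTC_Icc_real) (auto intro!: derivative_eq_intros simp: field_simps)
  then have intL: "(\<integral>x. L x * indicator {-1..1} x \<partial>lborel) = 2 - 1/3 + 1/20 - 1/168"
    "integrable lborel (\<lambda>x. L x * indicator {-1..1} x)"
    by (auto simp: has_bochner_integral_iff)
  have "has_bochner_integral lborel (\<lambda>x. R x * indicator {-1..1} x)
      ((1 - 1^3 / 6 + 1^5 / 40 - 1^7 / 336 + 1^9 / 3456)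
        - (-1 - (-1)^3 / 6 + (-1)^5 / 40 - (-1)^7 / 336 + (-1)^9 / 3456))"
    unfolding R_def L_def
    by (rule has_bochner_integral_FTC_Icc_real) (auto intro!: derivative_eq_intros simp: field_simps)
  then have intR: "(\<integral>x. R x * indicator {-1..1} x \<partial>lborel) = 2 - 1/3 + 1/20 - 1/168 + 1/1728"
    "integrable lborel (\<lambda>x. R x * indicator {-1..1} x)"
    by (auto simp: has_bochner_integral_iff)
  \<comment> \<open>The polynomials are integrated over the closed interval,
    \<open>core_mass\<close> over the open one.\<close>
  have ends: "AE x in lborel. x \<noteq> -1 \<and> x \<noteq> (1::real)"
    using AE_lborel_singleton[of "-1::real"] AE_lborel_singleton[of "1::real"] by auto
  have "(\<integral>x. L x * indicator {-1..1} x \<partial>lborel) \<le> core_mass"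
    unfolding core_mass_def using intL(2) integrable_core
    by (rule integral_mono_AE) (use ends L in \<open>auto split: split_indicator elim: eventually_mono\<close>)
  then show "1.7107 \<le> core_mass" by (simp add: intL)
  have "core_mass \<le> (\<integral>x. R x * indicator {-1..1} x \<partial>lborel)"
    unfolding core_mass_def using integrable_core intR(2)
    by (rule integral_mono_AE) (use ends R in \<open>auto split: split_indicator elim: eventually_mono\<close>)
  then show "core_mass \<le> 1.7113" by (simp add: intR)
qed

text \<open>\<open>p\<close> and \<open>q\<close> are the masses of \<open>(-1, 1)\<close> under the
  iterates and under \<open>rho_star\<close>. The expression decreases in \<open>p\<close> and
  increases in \<open>q\<close>, so an upper bound for \<open>p\<close> and a lower bound for
  \<open>q\<close> suffice.\<close>

lemma dual_value_gt:
  assumes p: "p = core_mass / (core_mass + 2 * exp (- (1 / 2)))" and q: "q = core_mass / sqrt (2 * pi)"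
  shows "0.019 < 1 + (p * ln (6 / 7) + (1 - p) * ln (17 / 13)) - (q * (6 / 7) + (1 - q) * (17 / 13))"
proof -
  have e: "1.2083 \<le> 2 * exp (- (1 / 2 :: real))"
    using exp_minus_ge[of "1 / 2"] by (simp add: power_numeral_reduce)
  \<comment> \<open>\<open>p\<close> increases with the core mass and decreases with the tail mass,
    hence the pair \<open>1.7113\<close> and \<open>1.2083\<close>.\<close>
  have p0: "0 \<le> p" "p \<le> 0.5862"
    using core_mass_bounds e unfolding p by (auto simp: field_simps)
  have "0.6815 * sqrt (2 * pi) \<le> core_mass"
    using sqrt_2_pi_le core_mass_bounds by simp
  then have q0: "0.6815 \<le> q"
    unfolding q by (simp add: field_simps)
  have "p * (- 0.1542) \<le> p * ln (6 / 7)" "(1 - p) * 0.2679 \<le> (1 - p) * ln (17 / 13)"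
    using p0 ln_6_7_ge ln_17_13_ge by (intro mult_left_mono; simp)+
  moreover have "0.0204 \<le> p * (- 0.1542) + (1 - p) * 0.2679"
    "q * (6 / 7) + (1 - q) * (17 / 13) \<le> 1.0007"
    using p0 q0 by (simp_all add: field_simps)
  \<comment> \<open>The margin is \<open>0.0204 - 0.0007 = 0.0197\<close>.\<close>
  moreover have "0.019 < 1 + (x + y) - z"
    if "x' \<le> x" "y' \<le> y" "0.0204 \<le> x' + y'" "z \<le> 1.0007" for x y z x' y' :: real
    using that by simp
  ultimately show ?thesis by blast
qed

section \<open>Profiles: a Gaussian core and two exponential tails\<close>

text \<open>The prefactor gives the tail the mass \<open>exp (- (1 / 2))\<close> for all
  \<open>a\<close> and all \<open>s > 0\<close>; with \<open>a = s = 1\<close> it is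
  \<open>exp (- (x - 1 / 2))\<close>, the right tail of \<open>exp (- V0 x)\<close>.\<close>

definition tail :: "real \<Rightarrow> real \<Rightarrow> real \<Rightarrow> real" where
  "tail a s x = (if a \<le> x then exp (- (1 / 2)) / s * exp (- ((x - a) / s)) else 0)"

definition profile :: "real \<Rightarrow> real \<Rightarrow> real \<Rightarrow> real" where
  "profile a s x = exp (- (x\<^sup>2 / 2)) * indicator {-1<..<1} x + tail a s x + tail a s (- x)"

lemma measurable_tail[measurable]: "tail a s \<in> borel_measurable borel"
  unfolding tail_def[abs_def] by measurable

lemma measurable_profile[measurable]: "profile a s \<in> borel_measurable borel"
  unfolding profile_def[abs_def] by measurable

lemma tail_nonneg: "0 < s \<Longrightarrow> 0 \<le> tail a s x"
  by (simp add: tail_def)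

lemma profile_nonneg: "0 < s \<Longrightarrow> 0 \<le> profile a s x"
  by (simp add: profile_def tail_nonneg)

lemma profile_core: "1 \<le> a \<Longrightarrow> \<bar>x\<bar> < 1 \<Longrightarrow> profile a s x = exp (- (x\<^sup>2 / 2))"
  by (auto simp: profile_def tail_def split: split_indicator)

lemma profile_tail:
  assumes "1 \<le> a" "a \<le> \<bar>x\<bar>"
  shows "profile a s x = exp (- (1 / 2)) / s * exp (- ((\<bar>x\<bar> - a) / s))"
  using assms by (cases "0 \<le> x") (auto simp: profile_def tail_def)

lemma profile_gap: "1 \<le> \<bar>x\<bar> \<Longrightarrow> \<bar>x\<bar> < a \<Longrightarrow> profile a s x = 0"
  by (auto simp: profile_def tail_def split: split_indicator)

lemma profile_initial: "profile 1 1 x = exp (- V0 x)"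
proof (cases "\<bar>x\<bar> < 1")
  case True
  then show ?thesis by (auto simp: profile_core V0_def)
next
  case False
  then show ?thesis by (auto simp: profile_tail V0_def simp flip: exp_add)
qed

section \<open>Transport of a profile by one Euler step\<close>

text \<open>The reflection \<open>x\<close> to \<open>- x\<close> turns the left tail into the right
  tail tested against \<open>g (- x)\<close>, so only one tail has to be studied.\<close>

lemma nn_integral_profile:
  assumes [measurable]: "g \<in> borel_measurable borel" and "0 < s" and "0 \<le> c"
  shows "(\<integral>\<^sup>+x. ennreal (profile a s x / c) * g x \<partial>lborel)
    = (\<integral>\<^sup>+x. ennreal (exp (- (x\<^sup>2 / 2)) * indicator {-1<..<1} x / c) * g x \<partial>lborel)
      + (\<integral>\<^sup>+x. ennreal (tail a s x / c) * g x \<partial>lborel)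
      + (\<integral>\<^sup>+x. ennreal (tail a s x / c) * g (- x) \<partial>lborel)"
proof -
  have "(\<integral>\<^sup>+x. ennreal (profile a s x / c) * g x \<partial>lborel)
    = (\<integral>\<^sup>+x. ennreal (exp (- (x\<^sup>2 / 2)) * indicator {-1<..<1} x / c) * g x
        + ennreal (tail a s x / c) * g x + ennreal (tail a s (- x) / c) * g x \<partial>lborel)"
    using assms(2,3)
    by (intro nn_integral_cong)
       (simp add: profile_def add_divide_distrib ennreal_plus tail_nonneg distrib_right)
  also have "\<dots> = (\<integral>\<^sup>+x. ennreal (exp (- (x\<^sup>2 / 2)) * indicator {-1<..<1} x / c) * g x \<partial>lborel)
      + (\<integral>\<^sup>+x. ennreal (tail a s x / c) * g x \<partial>lborel)
      + (\<integral>\<^sup>+x. ennreal (tail a s (- x) / c) * g x \<partial>lborel)"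
    by (simp add: nn_integral_add)
  also have "(\<integral>\<^sup>+x. ennreal (tail a s (- x) / c) * g x \<partial>lborel)
      = (\<integral>\<^sup>+x. ennreal (tail a s x / c) * g (- x) \<partial>lborel)"
    by (subst nn_integral_real_affine[where c = "- 1" and t = 0]) auto
  finally show ?thesis .
qed

text \<open>Tails are closed under increasing affine maps: the substitution
  \<open>y = t + k * x\<close> moves the starting point to \<open>t + k * a\<close>, and its
  Jacobian is absorbed by the prefactor \<open>1 / (k * s)\<close>.\<close>

lemma nn_integral_tail_affine:
  assumes [measurable]: "g \<in> borel_measurable borel" and "0 < s" "0 < k" "0 \<le> c"
  shows "(\<integral>\<^sup>+x. ennreal (tail a s x / c) * g (t + k * x) \<partial>lborel)
    = (\<integral>\<^sup>+x. ennreal (tail (t + k * a) (k * s) x / c) * g x \<partial>lborel)"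
proof -
  have scale: "k * tail (t + k * a) (k * s) (t + k * x) = tail a s x" for x
  proof -
    have "(t + k * x - (t + k * a)) / (k * s) = (x - a) / s"
      using assms by (simp add: field_simps)
    then show ?thesis using assms by (simp add: tail_def)
  qed
  have "(\<integral>\<^sup>+x. ennreal (tail (t + k * a) (k * s) x / c) * g x \<partial>lborel)
      = ennreal k * (\<integral>\<^sup>+x. ennreal (tail (t + k * a) (k * s) (t + k * x) / c) * g (t + k * x) \<partial>lborel)"
    using assms by (subst nn_integral_real_affine[where c = k and t = t]) auto
  also have "\<dots> = (\<integral>\<^sup>+x. ennreal (k * tail (t + k * a) (k * s) (t + k * x) / c) * g (t + k * x) \<partial>lborel)"
    using assms
    by (simp add: nn_integral_cmult[symmetric] mult.assoc[symmetric] ennreal_mult'[symmetric])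
  finally show ?thesis by (simp add: scale)
qed

text \<open>On the core the slopes of \<open>U\<close> and of the log density cancel; on the tails
  the log density has slope \<open>- sgn x / s\<close>. In the gap
  \<open>1 \<le> \<bar>x\<bar> < a\<close> there is no mass, and the tail formula is simply
  continued.\<close>

definition profile_velocity :: "real \<Rightarrow> real \<Rightarrow> real" where
  "profile_velocity s x = (if \<bar>x\<bar> < 1 then 0 else x - sgn x / s)"

lemma measurable_profile_velocity[measurable]: "profile_velocity s \<in> borel_measurable borel"
  unfolding profile_velocity_def[abs_def] by measurable

text \<open>The three summands of the profile are transported separately: the map is the identity on
  the core and affine with slope \<open>1 - k > 0\<close> on each tail.\<close>

lemma distr_profile:
  assumes "0 < k" "k < 1" "1 \<le> a" "0 < s" "0 \<le> c"
  shows "distr (density lborel (\<lambda>x. ennreal (profile a s x / c))) borel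
      (\<lambda>x. x - k * profile_velocity s x)
    = density lborel (\<lambda>x. ennreal (profile (k / s + (1 - k) * a) ((1 - k) * s) x / c))"
proof (rule measure_eqI)
  fix A assume "A \<in> sets (distr (density lborel (\<lambda>x. ennreal (profile a s x / c))) borel
      (\<lambda>x. x - k * profile_velocity s x))"
  then have [measurable]: "A \<in> sets borel" by simp
  let ?T = "\<lambda>x. x - k * profile_velocity s x"
  let ?a = "k / s + (1 - k) * a" and ?s = "(1 - k) * s"
  have out: "?T x = k / s + (1 - k) * x" "?T (- x) = - (k / s + (1 - k) * x)" if "a \<le> x" for x
    using that assms by (auto simp: profile_velocity_def algebra_simps)
  have "emeasure (distr (density lborel (\<lambda>x. ennreal (profile a s x / c))) borel ?T) A
     = (\<integral>\<^sup>+x. ennreal (profile a s x / c) * indicator A (?T x) \<partial>lborel)"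
    by (subst nn_integral_indicator[symmetric])
       (simp_all add: nn_integral_distr nn_integral_density del: nn_integral_indicator)
  also have "\<dots> = (\<integral>\<^sup>+x. ennreal (exp (- (x\<^sup>2 / 2)) * indicator {-1<..<1} x / c) * indicator A (?T x) \<partial>lborel)
      + (\<integral>\<^sup>+x. ennreal (tail a s x / c) * indicator A (?T x) \<partial>lborel)
      + (\<integral>\<^sup>+x. ennreal (tail a s x / c) * indicator A (?T (- x)) \<partial>lborel)"
    using assms by (intro nn_integral_profile) auto
  also have "(\<integral>\<^sup>+x. ennreal (exp (- (x\<^sup>2 / 2)) * indicator {-1<..<1} x / c) * indicator A (?T x) \<partial>lborel)
      = (\<integral>\<^sup>+x. ennreal (exp (- (x\<^sup>2 / 2)) * indicator {-1<..<1} x / c) * indicator A x \<partial>lborel)"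
    by (intro nn_integral_cong) (auto simp: profile_velocity_def split: split_indicator)
  also have "(\<integral>\<^sup>+x. ennreal (tail a s x / c) * indicator A (?T x) \<partial>lborel)
      = (\<integral>\<^sup>+x. ennreal (tail a s x / c) * indicator A (k / s + (1 - k) * x) \<partial>lborel)"
    by (intro nn_integral_cong) (simp add: tail_def out)
  also have "\<dots> = (\<integral>\<^sup>+x. ennreal (tail ?a ?s x / c) * indicator A x \<partial>lborel)"
    using assms by (intro nn_integral_tail_affine) auto
  also have "(\<integral>\<^sup>+x. ennreal (tail a s x / c) * indicator A (?T (- x)) \<partial>lborel)
      = (\<integral>\<^sup>+x. ennreal (tail a s x / c) * indicator A (- (k / s + (1 - k) * x)) \<partial>lborel)"
    by (intro nn_integral_cong) (simp add: tail_def out del: minus_add_distrib)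
  also have "\<dots> = (\<integral>\<^sup>+x. ennreal (tail ?a ?s x / c) * indicator A (- x) \<partial>lborel)"
    using assms by (intro nn_integral_tail_affine[where g = "\<lambda>x. indicator A (- x)"]) auto
  also have "(\<integral>\<^sup>+x. ennreal (exp (- (x\<^sup>2 / 2)) * indicator {-1<..<1} x / c) * indicator A x \<partial>lborel)
      + (\<integral>\<^sup>+x. ennreal (tail ?a ?s x / c) * indicator A x \<partial>lborel)
      + (\<integral>\<^sup>+x. ennreal (tail ?a ?s x / c) * indicator A (- x) \<partial>lborel)
      = (\<integral>\<^sup>+x. ennreal (profile ?a ?s x / c) * indicator A x \<partial>lborel)"
    using assms by (intro nn_integral_profile[symmetric]) auto
  also have "\<dots> = emeasure (density lborel (\<lambda>x. ennreal (profile ?a ?s x / c))) A"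
    by (simp add: emeasure_density)
  finally show "emeasure (distr (density lborel (\<lambda>x. ennreal (profile a s x / c))) borel ?T) A
    = emeasure (density lborel (\<lambda>x. ennreal (profile ?a ?s x / c))) A" .
qed simp

section \<open>Velocity of a profile\<close>

lemma is_KL_velocity_profile:
  assumes a: "1 \<le> a" and s: "0 < s" and c: "0 < c"
  shows "is_KL_velocity gauss_potential (density lborel (\<lambda>x. ennreal (profile a s x / c)))
    (profile_velocity s)"
proof -
  let ?r = "\<lambda>x. profile a s x / c"
  let ?L = "KL_first_variation gauss_potential ?r"
  have core: "(\<forall>\<^sub>F y in nhds x. 0 < ?r y) \<and> (?L has_real_derivative profile_velocity s x) (at x)"
    if x: "\<bar>x\<bar> < 1" for x
  proof
    have near: "\<forall>\<^sub>F y in nhds x. y \<in> {-1<..<1}"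
      using x by (intro eventually_nhds_in_open) auto
    then show "\<forall>\<^sub>F y in nhds x. 0 < ?r y"
      by eventually_elim (use a c in \<open>auto simp: profile_core abs_less_iff\<close>)
    have "?L y = 1 + ln (sqrt (2 * pi)) - ln c" if "y \<in> {-1<..<1}" for y
      using that a c
      by (auto simp: KL_first_variation_def gauss_potential_def profile_core abs_less_iff ln_div)
    with near have "\<forall>\<^sub>F y in nhds x. ?L y = 1 + ln (sqrt (2 * pi)) - ln c"
      by (auto elim: eventually_mono)
    then show "(?L has_real_derivative profile_velocity s x) (at x)"
      using x by (subst DERIV_cong_ev[OF refl _ refl]) (auto simp: profile_velocity_def)
  qed
  have outer: "(\<forall>\<^sub>F y in nhds x. 0 < ?r y) \<and> (?L has_real_derivative profile_velocity s x) (at x)"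
    if x: "a < \<bar>x\<bar>" for x
  proof
    \<comment> \<open>On this half-line \<open>\<bar>y\<bar> = sgn x * y\<close>, so the log density
      is affine there.\<close>
    define S where "S = (if 0 < x then {a<..} else {..<-a})"
    have near: "\<forall>\<^sub>F y in nhds x. y \<in> S"
      using x a by (intro eventually_nhds_in_open) (auto simp: S_def)
    have S: "a \<le> \<bar>y\<bar> \<and> \<bar>y\<bar> = sgn x * y" if "y \<in> S" for y
      using that x a by (auto simp: S_def sgn_if split: if_splits)
    have "0 < ?r y" if "y \<in> S" for y
      using S[OF that] a s c by (simp add: profile_tail)
    with near show "\<forall>\<^sub>F y in nhds x. 0 < ?r y"
      by (auto elim: eventually_mono)
    have "?L y = 1 + (y\<^sup>2 / 2 + ln (sqrt (2 * pi))) + (- (1 / 2) - ln s - (sgn x * y - a) / s - ln c)"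
      if "y \<in> S" for y
      using S[OF that] a c s
      by (simp add: KL_first_variation_def gauss_potential_def profile_tail ln_div ln_mult)
    with near have *: "\<forall>\<^sub>F y in nhds x. ?L y
        = 1 + (y\<^sup>2 / 2 + ln (sqrt (2 * pi))) + (- (1 / 2) - ln s - (sgn x * y - a) / s - ln c)"
      by (auto elim: eventually_mono)
    show "(?L has_real_derivative profile_velocity s x) (at x)"
      using x a s
      by (subst DERIV_cong_ev[OF refl * refl])
         (auto intro!: derivative_eq_intros simp: profile_velocity_def)
  qed
  have "AE x in lborel. x \<noteq> a \<and> x \<noteq> - a"
    using AE_lborel_singleton[of a] AE_lborel_singleton[of "- a"] by auto
  \<comment> \<open>This is the almost-everywhere statement for the density read over
    \<open>lborel\<close>: the gap satisfies it vacuously, and the possible jumps at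
    \<open>a\<close> and \<open>- a\<close> form a null set.\<close>
  then have "AE x in lborel. 0 < ennreal (?r x) \<longrightarrow>
      (\<forall>\<^sub>F y in nhds x. 0 < ?r y) \<and> (?L has_real_derivative profile_velocity s x) (at x)"
  proof eventually_elim
    case (elim x)
    consider "\<bar>x\<bar> < 1" | "1 \<le> \<bar>x\<bar>" "\<bar>x\<bar> < a" | "a < \<bar>x\<bar>"
      using elim by linarith
    then show ?case
      by cases (use core outer profile_gap in auto)
  qed
  then show ?thesis
    unfolding is_KL_velocity_def using s c
    by (intro conjI exI[of _ ?r]) (auto simp: AE_density profile_nonneg)
qed

section \<open>Total mass and mass of the core\<close>

lemma nn_integral_tail:
  assumes "0 < s" "0 < c"
  shows "(\<integral>\<^sup>+x. ennreal (tail a s x / c) \<partial>lborel) = ennreal (exp (- (1 / 2)) / c)"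
proof -
  have "(\<integral>\<^sup>+x. ennreal (tail a s x / c) \<partial>lborel)
    = (\<integral>\<^sup>+x. ennreal (exp (- (1 / 2)) / c * (exp (- ((x - a) / s)) / s)) * indicator {a..} x \<partial>lborel)"
    by (intro nn_integral_cong) (auto simp: tail_def mult.commute)
  also have "\<dots> = ennreal (0 - - (exp (- (1 / 2)) / c * exp (- ((a - a) / s))))"
  proof (rule nn_integral_FTC_atLeast[where F = "\<lambda>x. - (exp (- (1 / 2)) / c * exp (- ((x - a) / s)))"])
    show "((\<lambda>x. - (exp (- (1 / 2)) / c * exp (- ((x - a) / s)))) has_real_derivative
        exp (- (1 / 2)) / c * (exp (- ((x - a) / s)) / s)) (at x)" for x
      using assms by (auto intro!: derivative_eq_intros simp: mult.commute)
    have "LIM x at_top. - (a / s) + 1 / s * x :> at_top"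
      using assms
      by (intro filterlim_tendsto_add_at_top[OF tendsto_const]
          filterlim_tendsto_pos_mult_at_top[OF tendsto_const _ filterlim_ident]) auto
    then have "LIM x at_top. - ((x - a) / s) :> at_bot"
      by (simp add: filterlim_uminus_at_top diff_divide_distrib)
    then have "((\<lambda>x. exp (- ((x - a) / s))) \<longlongrightarrow> 0) at_top"
      by (rule filterlim_compose[OF exp_at_bot])
    then show "((\<lambda>x. - (exp (- (1 / 2)) / c * exp (- ((x - a) / s)))) \<longlongrightarrow> 0) at_top"
      using tendsto_mult_left[of _ 0 at_top "- (exp (- (1 / 2)) / c)"] by simp
  qed (use assms in auto)
  finally show ?thesis by simp
qed

lemma nn_integral_core:
  "0 \<le> c \<Longrightarrow> (\<integral>\<^sup>+x. ennreal (exp (- (x\<^sup>2 / 2)) * indicator {-1<..<1} x / c) \<partial>lborel) = ennreal (core_mass / c)"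
  using integrable_core unfolding core_mass_def
  by (subst nn_integral_eq_integral) auto

lemma nn_integral_profile_total:
  assumes "0 < s" "0 < c"
  shows "(\<integral>\<^sup>+x. ennreal (profile a s x / c) \<partial>lborel)
    = ennreal ((core_mass + 2 * exp (- (1 / 2))) / c)"
proof -
  have "(\<integral>\<^sup>+x. ennreal (profile a s x / c) \<partial>lborel)
      = ennreal (core_mass / c) + ennreal (exp (- (1 / 2)) / c) + ennreal (exp (- (1 / 2)) / c)"
    using nn_integral_profile[of "\<lambda>_. 1" s c a] assms nn_integral_core[of c]
    by (simp add: nn_integral_tail)
  also have "\<dots> = ennreal ((core_mass + 2 * exp (- (1 / 2))) / c)"
    using core_mass_bounds assms by (simp add: add_divide_distrib flip: ennreal_plus)
  finally show ?thesis .
qed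

lemma D0_eq: "D0 = core_mass + 2 * exp (- (1 / 2))"
proof -
  have "(\<lambda>x. exp (- V0 x)) \<in> borel_measurable lborel"
    unfolding profile_initial[symmetric] by simp
  then show ?thesis
    unfolding D0_def using core_mass_bounds nn_integral_profile_total[of 1 1 1]
    by (subst integral_eq_nn_integral) (auto simp: profile_initial simp del: ennreal_plus)
qed

lemma D0_pos: "0 < D0"
  using core_mass_bounds by (simp add: D0_eq add_pos_pos)

lemma prob_space_profile:
  "0 < s \<Longrightarrow> prob_space (density lborel (\<lambda>x. ennreal (profile a s x / D0)))"
  using D0_pos
  by (intro prob_spaceI) (simp add: emeasure_density nn_integral_profile_total flip: D0_eq)

lemma rho0_eq: "rho0 = density lborel (\<lambda>x. ennreal (profile 1 1 x / D0))"
  by (simp add: rho0_def profile_initial)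

text \<open>With \<open>a \<ge> 1\<close> both tails stay off \<open>(-1, 1)\<close>, so its mass
  depends on neither \<open>a\<close> nor \<open>s\<close>. This is the quantity conserved by the
  scheme.\<close>

lemma measure_core_profile:
  assumes "1 \<le> a" "0 < s"
  shows "measure (density lborel (\<lambda>x. ennreal (profile a s x / D0))) {-1<..<1} = core_mass / D0"
proof -
  have "emeasure (density lborel (\<lambda>x. ennreal (profile a s x / D0))) {-1<..<1}
      = (\<integral>\<^sup>+x. ennreal (exp (- (x\<^sup>2 / 2)) * indicator {-1<..<1} x / D0) \<partial>lborel)"
    using assms
    by (auto simp: emeasure_density profile_core abs_less_iff split: split_indicator
        intro!: nn_integral_cong)
  then show ?thesis
    using nn_integral_core[of D0] D0_pos core_mass_bounds by (simp add: measure_def)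
qed

lemma rho_star_eq: "rho_star = density lborel (\<lambda>x. ennreal (std_normal_density x))"
proof -
  have "exp (- gauss_potential x) = std_normal_density x" for x
  proof -
    have "- gauss_potential x = - x\<^sup>2 / 2 - ln (sqrt (2 * pi))"
      by (simp add: gauss_potential_def)
    then show ?thesis
      by (simp only: exp_diff std_normal_density_def) simp
  qed
  then show ?thesis by (simp add: rho_star_def)
qed

lemma prob_space_rho_star: "prob_space rho_star"
  unfolding rho_star_eq by (rule prob_space_normal_density) simp

lemma measure_core_rho_star: "measure rho_star {-1<..<1} = core_mass / sqrt (2 * pi)"
proof -
  have "emeasure rho_star {-1<..<1}
      = (\<integral>\<^sup>+x. ennreal (exp (- (x\<^sup>2 / 2)) * indicator {-1<..<1} x / sqrt (2 * pi)) \<partial>lborel)"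
    by (auto simp: rho_star_eq std_normal_density_def emeasure_density split: split_indicator
        intro!: nn_integral_cong)
  then show ?thesis
    using nn_integral_core[of "sqrt (2 * pi)"] core_mass_bounds by (simp add: measure_def)
qed

section \<open>Invariance along the scheme and conclusion\<close>

text \<open>The bound \<open>s \<le> 1\<close> is carried in the induction because it is what keeps
  the next \<open>a\<close> at least \<open>1\<close>.\<close>

lemma forward_euler_profile:
  assumes h: "\<And>n. h n \<in> {0<..<1}"
  shows "\<exists>a s. 1 \<le> a \<and> 0 < s \<and> s \<le> 1 \<and>
    forward_euler gauss_potential h rho0 n = density lborel (\<lambda>x. ennreal (profile a s x / D0))"
proof (induction n)
  case 0
  show ?case by (rule exI[of _ 1], rule exI[of _ 1]) (simp add: rho0_eq)
next
  case (Suc n)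
  then obtain a s where as: "1 \<le> a" "0 < s" "s \<le> 1"
    and M: "forward_euler gauss_potential h rho0 n = density lborel (\<lambda>x. ennreal (profile a s x / D0))"
    (is "_ = ?M") by blast
  have hn: "0 < h n" "h n < 1" using h[of n] by auto
  have vel: "is_KL_velocity gauss_potential ?M (profile_velocity s)"
    using as D0_pos by (intro is_KL_velocity_profile) auto
  \<comment> \<open>The chosen velocity is a genuine one because \<open>profile_velocity s\<close>
    is a witness; by uniqueness the two agree almost everywhere and give the same
    pushforward.\<close>
  then have KLv: "is_KL_velocity gauss_potential ?M (KL_velocity gauss_potential ?M)"
    unfolding KL_velocity_def by (rule someI[of "is_KL_velocity gauss_potential ?M"])
  have "AE x in ?M. euler_map gauss_potential (h n) ?M x = x - h n * profile_velocity s x"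
    using is_KL_velocity_unique[OF KLv vel] by eventually_elim (simp add: euler_map_def)
  moreover have "euler_map gauss_potential (h n) ?M \<in> borel_measurable borel"
    using KLv by (auto simp: is_KL_velocity_def euler_map_def[abs_def])
  ultimately have "forward_euler gauss_potential h rho0 (Suc n)
      = distr ?M borel (\<lambda>x. x - h n * profile_velocity s x)"
    by (simp add: M) (rule distr_cong_AE; simp)
  also have "\<dots> = density lborel
      (\<lambda>x. ennreal (profile (h n / s + (1 - h n) * a) ((1 - h n) * s) x / D0))"
    using hn as D0_pos by (intro distr_profile) auto
  finally have "forward_euler gauss_potential h rho0 (Suc n) = \<dots>" .
  \<comment> \<open>A convex combination of \<open>1 / s \<ge> 1\<close> and
    \<open>a \<ge> 1\<close>.\<close>
  moreover have "1 \<le> h n / s + (1 - h n) * a"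
  proof -
    have "h n \<le> h n / s"
      using hn as by (simp add: field_simps)
    moreover have "(1 - h n) * 1 \<le> (1 - h n) * a"
      using hn as by (intro mult_left_mono) auto
    ultimately show ?thesis by simp
  qed
  moreover have "0 < (1 - h n) * s" "(1 - h n) * s \<le> 1"
    using hn as by (auto intro: mult_le_one)
  ultimately show ?case by blast
qed

lemma (in prob_space) has_bochner_integral_two_valued:
  fixes u v :: real
  assumes "A \<in> events"
  shows "has_bochner_integral M (\<lambda>x. indicator A x * u + (1 - indicator A x) * v)
    (prob A * u + (1 - prob A) * v)"
proof -
  have "has_bochner_integral M (indicator A :: _ \<Rightarrow> real) (prob A)"
    using assms by (intro has_bochner_integral_real_indicator) (auto simp: less_top[symmetric])
  moreover have "has_bochner_integral M (\<lambda>_. 1) (1 :: real)"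
    by (simp add: has_bochner_integral_iff prob_space)
  ultimately show ?thesis
    by (intro has_bochner_integral_add has_bochner_integral_mult_left has_bochner_integral_diff)
qed

theorem theorem3p3:
  fixes h :: "nat \<Rightarrow> real"
  assumes "\<And>n. h n \<in> {0<..<1}"
  shows "\<forall>n. KL (forward_euler gauss_potential h rho0 n) rho_star > ereal 0.019"
proof
  fix n
  obtain a s where as: "1 \<le> a" "0 < s"
    and M: "forward_euler gauss_potential h rho0 n = density lborel (\<lambda>x. ennreal (profile a s x / D0))"
    (is "_ = ?M") using forward_euler_profile[of h n] assms by blast
  interpret M: prob_space ?M using as by (intro prob_space_profile)
  interpret N: prob_space rho_star by (rule prob_space_rho_star)
  have [simp]: "sets rho_star = sets borel" "space rho_star = UNIV"
    by (simp_all add: rho_star_def)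
  let ?A = "{-1<..<1::real}"
  \<comment> \<open>\<open>6/7\<close> and \<open>17/13\<close> approximate the optimal values \<open>\<rho>\<^sub>n(B) / \<rho>\<^sup>*(B)\<close> for \<open>B = A\<close> and \<open>B = - A\<close>.\<close>
  define \<psi> where "\<psi> x = indicator ?A x * ln (6 / 7) + (1 - indicator ?A x) * ln (17 / 13 :: real)" for x
  have exp_psi: "exp (\<psi> x) = indicator ?A x * (6 / 7) + (1 - indicator ?A x) * (17 / 13)" for x
    by (auto simp: \<psi>_def split: split_indicator)
  have M_psi: "has_bochner_integral ?M \<psi> (measure ?M ?A * ln (6 / 7) + (1 - measure ?M ?A) * ln (17 / 13))"
    unfolding \<psi>_def by (rule M.has_bochner_integral_two_valued) simp
  have N_psi: "has_bochner_integral rho_star (\<lambda>x. exp (\<psi> x))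
      (measure rho_star ?A * (6 / 7) + (1 - measure rho_star ?A) * (17 / 13))"
    unfolding exp_psi by (rule N.has_bochner_integral_two_valued) simp
  \<comment> \<open>Only the two masses of \<open>?A\<close> enter, so \<open>a\<close>,
    \<open>s\<close> and \<open>n\<close> drop out and one numerical inequality covers all
    iterates.\<close>
  have "0.019 < 1 + (\<integral>x. \<psi> x \<partial>?M) - (\<integral>x. exp (\<psi> x) \<partial>rho_star)"
    unfolding has_bochner_integral_integral_eq[OF M_psi] has_bochner_integral_integral_eq[OF N_psi]
      measure_core_profile[OF as] measure_core_rho_star
    by (rule dual_value_gt) (simp_all only: D0_eq)
  then have "ereal 0.019 < ereal (1 + (\<integral>x. \<psi> x \<partial>?M) - (\<integral>x. exp (\<psi> x) \<partial>rho_star))"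
    by simp
  also have "\<dots> \<le> KL ?M rho_star"
    using M_psi N_psi M.prob_space_axioms N.prob_space_axioms
    by (intro KL_ge_dual) (auto simp: has_bochner_integral_iff)
  finally show "ereal 0.019 < KL (forward_euler gauss_potential h rho0 n) rho_star"
    unfolding M .
qed

end
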